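(* Let $\mathcal{G}$ be a strongly connected directed graph with $n$ nodes, and let $\varphi:\mathbb{R}^N\to\mathbb{R}$ be an analytic function. Then any vector field $\psi(z)=e_i\,\varphi(z)$, $e_i\in\mathbb{R}^N$, $i=1,2,\dots,N$, can be written as a possibly infinite sum of Lie brackets of admissible vector fields.
   Context: State and index sets. Agents are the nodes $v_1,\dots,v_n$ of $\mathcal{G}=(\mathcal{V},\mathcal{E})$. Agent $i$ has $p_i\ge 0$ associated equality-constraint multipliers and $q_i\ge 0$ associated inequality-constraint multipliers. Put $p=\sum_i p_i$, $q=\sum_i q_i$, $N=n+p+q$. The complete state is $z=[x^\top,\nu^\top,\lambda^\top]^\top\in\mathbb{R}^N$ with $x\in\mathbb{R}^n$, $\nu\in\mathbb{R}^p$, $\lambda\in\mathbb{R}^q$. For $i=1,\dots,n$ let $$\bar{\mathcal{I}}(i)=\{i\}\cup\{n+\textstyle\sum_{k=1}^{i-1}p_k+\ell:\ \ell=1,\dots,p_i\}\cup\{n+p+\sum_{k=1}^{i-1}q_k+\ell:\ \ell=1,\dots,q_i\},$$ the set of indices of components of $z$ belonging to agent $i$. These sets partition $\{1,\dots,N\}$. $z_{\mathcal{S}}$ denotes the ordered stacked vector of the $z_s$, $s\in\mathcal{S}$. $e_i\in\mathbb{R}^N$ is the $i$th unit vector. Graph. An edge $(v_i,v_j)\in\mathcal{E}$ means that agent $i$ receives information from agent $j$. Strongly connected means that there is a directed path from every node to every other node. Admissibility. A vector field on $\mathbb{R}^N$ is admissible if it can be computed locally by the agents: each component with index in $\bar{\mathcal{I}}(k)$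 depends only on $z_{\bar{\mathcal{I}}(k)}$ and on $z_{\bar{\mathcal{I}}(\ell)}$ for those $\ell$ with $(v_k,v_\ell)\in\mathcal{E}$. Lie brackets. $[f_1,f_2](z)=\frac{\partial f_2}{\partial z}(z)f_1(z)-\frac{\partial f_1}{\partial z}(z)f_2(z)$. "A Lie bracket of admissible vector fields" means an iterated Lie bracket (with arbitrary nesting) whose entries are admissible vector fields; an admissible vector field itself is regarded as a bracket of length one. *)

theory Defs
  imports "HOL-Analysis.Analysis" "Graph_Theory.Digraph_Component"
begin

text \<open>Agents are the numbers \<open>1, \<dots>, n\<close>; agent \<open>k\<close> owns \<open>p k\<close> equality and \<open>q k\<close> inequality
  multipliers. All index sets below are sets of 1-based positions in the stacked state
  \<open>z = (x, \<nu>, \<lambda>)\<close>.\<close>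

definition state_dim :: "nat \<Rightarrow> (nat \<Rightarrow> nat) \<Rightarrow> (nat \<Rightarrow> nat) \<Rightarrow> nat" where
  "state_dim n p q = n + (\<Sum>k=1..n. p k) + (\<Sum>k=1..n. q k)"

definition agent_indices :: "nat \<Rightarrow> (nat \<Rightarrow> nat) \<Rightarrow> (nat \<Rightarrow> nat) \<Rightarrow> nat \<Rightarrow> nat set" where
  "agent_indices n p q i =
     {i}
     \<union> {n + (\<Sum>k=1..<i. p k) + l | l. l \<in> {1..p i}}
     \<union> {n + (\<Sum>k=1..n. p k) + (\<Sum>k=1..<i. q k) + l | l. l \<in> {1..q i}}"

text \<open>Elements of \<open>real ^ 'm\<close> have components indexed by a type. The argument \<open>\<iota>\<close> numbers them:
  \<open>z $ \<iota> s\<close> is the \<open>s\<close>-th component of \<open>z\<close>, where \<open>\<iota>\<close> is a bijection from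
  \<open>{1..state_dim n p q}\<close> onto \<open>'m\<close>. An arc \<open>(k, l)\<close> of \<open>G\<close> means that agent \<open>k\<close> receives
  information from agent \<open>l\<close>.\<close>

definition admissible ::
  "nat pair_pre_digraph \<Rightarrow> nat \<Rightarrow> (nat \<Rightarrow> nat) \<Rightarrow> (nat \<Rightarrow> nat) \<Rightarrow> (nat \<Rightarrow> 'm::finite)
     \<Rightarrow> (real ^ 'm \<Rightarrow> real ^ 'm) \<Rightarrow> bool" where
  "admissible G n p q \<iota> f \<longleftrightarrow>
     (\<forall>k\<in>{1..n}. \<forall>s\<in>agent_indices n p q k. \<forall>z w.
        (\<forall>r \<in> agent_indices n p q k \<union> (\<Union>l\<in>{l. (k, l) \<in> parcs G}. agent_indices n p q l).
            z $ \<iota> r = w $ \<iota> r)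
        \<longrightarrow> f z $ \<iota> s = f w $ \<iota> s)"

primrec times_differentiable ::
  "nat \<Rightarrow> ('a::real_normed_vector \<Rightarrow> 'b::real_normed_vector) \<Rightarrow> bool" where
  "times_differentiable 0 f \<longleftrightarrow> continuous_on UNIV f"
| "times_differentiable (Suc k) f \<longleftrightarrow>
     (\<forall>z. f differentiable (at z)) \<and>
     (\<forall>v. times_differentiable k (\<lambda>z. frechet_derivative f (at z) v))"

text \<open>On a finite-dimensional domain this is \<open>C\<^sup>\<infinity>\<close>: all iterated directional derivatives exist
  and are continuous.\<close>

definition smooth :: "('a::real_normed_vector \<Rightarrow> 'b::real_normed_vector) \<Rightarrow> bool" where
  "smooth f \<longleftrightarrow> (\<forall>k. times_differentiable k f)"

text \<open>Only meaningful for differentiable \<open>f\<^sub>1\<close>, \<open>f\<^sub>2\<close>; it is applied to smooth fields, whose brackets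
  are again smooth.\<close>

definition lie_bracket ::
  "('a::real_normed_vector \<Rightarrow> 'a) \<Rightarrow> ('a \<Rightarrow> 'a) \<Rightarrow> 'a \<Rightarrow> 'a" where
  "lie_bracket f\<^sub>1 f\<^sub>2 z =
     frechet_derivative f\<^sub>2 (at z) (f\<^sub>1 z) - frechet_derivative f\<^sub>1 (at z) (f\<^sub>2 z)"

inductive_set lie_brackets ::
  "('a::real_normed_vector \<Rightarrow> 'a) set \<Rightarrow> ('a \<Rightarrow> 'a) set" for F where
  entry: "f \<in> F \<Longrightarrow> f \<in> lie_brackets F"
| bracket: "f \<in> lie_brackets F \<Longrightarrow> g \<in> lie_brackets F \<Longrightarrow> lie_bracket f g \<in> lie_brackets F"

text \<open>Real analyticity on all of \<open>real ^ 'm\<close>: near every point \<open>a\<close> the function is the (unconditional)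
  sum of a power series in \<open>z - a\<close>, indexed by the multi-indices \<open>\<alpha> :: 'm \<Rightarrow> nat\<close>.\<close>

definition real_analytic :: "(real ^ 'm::finite \<Rightarrow> real) \<Rightarrow> bool" where
  "real_analytic \<phi> \<longleftrightarrow>
     (\<forall>a. \<exists>r>0. \<exists>c :: ('m \<Rightarrow> nat) \<Rightarrow> real. \<forall>z\<in>ball a r.
        ((\<lambda>\<alpha>. c \<alpha> * (\<Prod>s\<in>UNIV. (z $ s - a $ s) ^ \<alpha> s)) has_sum \<phi> z) UNIV)"

end

theory Submission
  imports Defs
begin

text \<open>A product of powers of coordinates times a unit vector is a single Lie bracket. First,
  \<open>[u(z\<^sub>j) e\<^sub>a, z\<^sub>a e\<^sub>i] = u(z\<^sub>j) e\<^sub>i\<close> whenever \<open>a \<noteq> i\<close> and \<open>j \<noteq> i\<close>, which transports a function of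
  one coordinate along a path of the graph, one arc at a time. Second, if \<open>g\<close> does not depend on
  \<open>z\<^sub>i\<close> and \<open>H\<close> is an antiderivative of \<open>h\<close>, then \<open>[g(z) e\<^sub>a, H(z\<^sub>a) e\<^sub>i] = g(z) h(z\<^sub>a) e\<^sub>i\<close>, which
  multiplies in one coordinate after the other, the coordinate \<open>i\<close> of the target coming last.
  The continuous function \<open>\<phi>\<close> is a locally uniform limit of polynomials by Stone--Weierstrass, and
  the differences of consecutive approximants can be cut into so many small multiples of monomials
  that the partial sums inside each block converge as well.\<close>

subsection \<open>Brackets of coordinate fields\<close>

text \<open>Both fields have a constant direction, so differentiating them only differentiates the
  scalar factors. In every later use \<open>g\<close> is constant along \<open>axis i 1\<close>,
  which removes the second term.\<close>

lemma lie_bracket_axis: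
  fixes g h :: "real ^ 'm::finite \<Rightarrow> real"
  assumes g: "(g has_derivative g') (at z)" and h: "(h has_derivative h') (at z)"
  shows "lie_bracket (\<lambda>z. g z *\<^sub>R axis a 1) (\<lambda>z. h z *\<^sub>R axis i 1) z =
           (g z * h' (axis a 1)) *\<^sub>R axis i 1 - (h z * g' (axis i 1)) *\<^sub>R axis a 1"
proof -
  have "((\<lambda>z. g z *\<^sub>R axis a (1::real)) has_derivative (\<lambda>v. g' v *\<^sub>R axis a 1)) (at z)"
    using g by (rule has_derivative_scaleR_left)
  then have 1: "frechet_derivative (\<lambda>z. g z *\<^sub>R axis a (1::real)) (at z) = (\<lambda>v. g' v *\<^sub>R axis a 1)"
    using frechet_derivative_at by metis
  have "((\<lambda>z. h z *\<^sub>R axis i (1::real)) has_derivative (\<lambda>v. h' v *\<^sub>R axis i 1)) (at z)"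
    using h by (rule has_derivative_scaleR_left)
  then have 2: "frechet_derivative (\<lambda>z. h z *\<^sub>R axis i (1::real)) (at z) = (\<lambda>v. h' v *\<^sub>R axis i 1)"
    using frechet_derivative_at by metis
  have "g' (g z *\<^sub>R x) = g z * g' x" "g' (h z *\<^sub>R x) = h z * g' x" "h' (g z *\<^sub>R x) = g z * h' x" for x
    using linear_cmul[OF has_derivative_linear[OF g]] linear_cmul[OF has_derivative_linear[OF h]]
    by simp_all
  then show ?thesis
    unfolding lie_bracket_def 1 2 by simp
qed

lemma has_derivative_coordinate_power:
  "((\<lambda>z::real ^ 'm::finite. c * z $ j ^ k) has_derivative (\<lambda>v. c * real k * z $ j ^ (k - 1) * v $ j)) (at z)"
  by (rule derivative_eq_intros bounded_linear_imp_has_derivative[OF bounded_linear_vec_nth] refl)+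
     (simp add: mult_ac)

lemma smooth_coordinate_power:
  "smooth (\<lambda>z::real ^ 'm::finite. (c * z $ j ^ k) *\<^sub>R (axis i 1 :: real ^ 'm))"
proof -
  have "times_differentiable d (\<lambda>z::real ^ 'm. (c * z $ j ^ k) *\<^sub>R (axis i 1 :: real ^ 'm))" for d
  \<comment> \<open>A directional derivative is again a field of this shape, with constant
    \<open>c * real k * v $ j\<close> and exponent \<open>k - 1\<close>, hence the generalisation.
    For \<open>k = 0\<close> the truncated exponent is harmless because the factor
    \<open>real k\<close> vanishes.\<close>
  proof (induction d arbitrary: c k)
    case 0
    then show ?case by (auto intro!: continuous_intros)
  next
    case (Suc d)
    have D: "((\<lambda>z::real ^ 'm. (c * z $ j ^ k) *\<^sub>R (axis i 1 :: real ^ 'm)) has_derivative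
        (\<lambda>v. (c * real k * z $ j ^ (k - 1) * v $ j) *\<^sub>R axis i 1)) (at z)" for z
      by (rule has_derivative_scaleR_left) (rule has_derivative_coordinate_power)
    have "frechet_derivative (\<lambda>z::real ^ 'm. (c * z $ j ^ k) *\<^sub>R (axis i 1 :: real ^ 'm)) (at z) v =
        ((c * real k * v $ j) * z $ j ^ (k - 1)) *\<^sub>R axis i 1" for z v
      using frechet_derivative_at[OF D, symmetric] by (simp add: mult_ac)
    then show ?case
      using Suc.IH D by (simp add: differentiable_def) blast
  qed
  then show ?thesis by (simp add: smooth_def)
qed

text \<open>\<open>F\<close> contains the fields whose information needs at most one arc; longer
  distances are covered by induction along the path, starting from the owner of \<open>j\<close>.
  The assumption on \<open>E\<close> supplies, at each intermediate agent, a coordinate that can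
  serve as a relay.\<close>

lemma coordinate_power_field_in_lie_brackets:
  fixes owner :: "'m::finite \<Rightarrow> 'v" and F :: "(real ^ 'm \<Rightarrow> real ^ 'm) set"
  assumes F: "\<And>c k i j. owner i = owner j \<or> (owner i, owner j) \<in> E \<Longrightarrow>
      (\<lambda>z. (c * z $ j ^ k) *\<^sub>R axis i 1) \<in> F"
    and E: "\<And>u v. (u, v) \<in> E \<Longrightarrow> v \<in> range owner"
    and path: "(owner i, owner j) \<in> E\<^sup>*"
  shows "(\<lambda>z. (c * z $ j ^ k) *\<^sub>R axis i 1) \<in> lie_brackets F"
proof -
  have "owner i = u \<Longrightarrow> (\<lambda>z. (c * z $ j ^ k) *\<^sub>R axis i 1) \<in> lie_brackets F"
    if "(u, owner j) \<in> E\<^sup>*" for u i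
    using that
  proof (induction arbitrary: i rule: converse_rtrancl_induct)
    case base
    then show ?case by (intro lie_brackets.entry F) simp
  next
    case (step u v)
    show ?case
    \<comment> \<open>The first alternative is an element of \<open>F\<close>; the second arises
      from a loop and is the induction hypothesis for \<open>i\<close> itself. Outside both,
      \<open>j \<noteq> i\<close>, so \<open>z $ j ^ k\<close> is constant along
      \<open>axis i 1\<close> and the bracket below has only one term.\<close>
    proof (cases "owner i = owner j \<or> owner i = v")
      case True
      then show ?thesis using step.IH by (auto intro: lie_brackets.entry F)
    next
      case False
      obtain a where a: "owner a = v" using E[OF step.hyps(1)] by blast
      have ne: "a \<noteq> i" "j \<noteq> i" using False a by auto
      have "(\<lambda>z. (1 * z $ a ^ 1) *\<^sub>R axis i 1) \<in> lie_brackets F"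
        using step.hyps(1) step.prems a by (intro lie_brackets.entry F) auto
      then have "lie_bracket (\<lambda>z. (c * z $ j ^ k) *\<^sub>R axis a 1) (\<lambda>z. (1 * z $ a ^ 1) *\<^sub>R axis i 1)
          \<in> lie_brackets F"
        using step.IH[OF a] by (intro lie_brackets.bracket)
      also have "lie_bracket (\<lambda>z. (c * z $ j ^ k) *\<^sub>R axis a 1) (\<lambda>z. (1 * z $ a ^ 1) *\<^sub>R axis i 1) =
          (\<lambda>z. (c * z $ j ^ k) *\<^sub>R axis i 1)"
        using ne lie_bracket_axis[OF has_derivative_coordinate_power has_derivative_coordinate_power,
            of c j k a 1 a 1 i]
        by (intro ext) (simp add: axis_def)
      finally show ?thesis .
    qed
  qed
  then show ?thesis using path by blast
qed

lemma monomial_field_in_lie_brackets: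
  fixes F :: "(real ^ 'm::finite \<Rightarrow> real ^ 'm) set"
  assumes powers: "\<And>c k i j. (\<lambda>z. (c * z $ j ^ k) *\<^sub>R axis i 1) \<in> lie_brackets F"
  shows "(\<lambda>z. (c * (\<Prod>s\<in>UNIV. z $ s ^ \<alpha> s)) *\<^sub>R axis i 1) \<in> lie_brackets F"
proof -
  \<comment> \<open>The target moves from \<open>a\<close> to \<open>i\<close> while the power of
    \<open>z $ a\<close> is multiplied in: \<open>?h\<close> is the antiderivative of that power,
    and \<open>i \<notin> S\<close> makes \<open>?g\<close> constant along \<open>axis i 1\<close>.
    The case \<open>a = i\<close> is allowed.\<close>
  have insert_step: "(\<lambda>z. (c * (\<Prod>s\<in>insert a S. z $ s ^ \<alpha> s)) *\<^sub>R axis i 1) \<in> lie_brackets F"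
    if g: "(\<lambda>z. (c * (\<Prod>s\<in>S. z $ s ^ \<alpha> s)) *\<^sub>R axis a 1) \<in> lie_brackets F"
      and notin: "a \<notin> S" "i \<notin> S" for a i :: 'm and S
  proof -
    let ?g = "\<lambda>z::real ^ 'm. c * (\<Prod>s\<in>S. z $ s ^ \<alpha> s)"
    let ?h = "\<lambda>z::real ^ 'm. 1 / real (Suc (\<alpha> a)) * z $ a ^ Suc (\<alpha> a)"
    let ?g' = "\<lambda>z v::real ^ 'm. c * (\<Sum>t\<in>S. (1 * real (\<alpha> t) * z $ t ^ (\<alpha> t - 1) * v $ t) *
        (\<Prod>s\<in>S - {t}. z $ s ^ \<alpha> s))"
    have dg: "(?g has_derivative ?g' z) (at z)" for z
      using has_derivative_coordinate_power[where c = 1]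
      by (intro has_derivative_mult_right has_derivative_prod) simp
    have g'_i: "?g' z (axis i 1) = 0" for z
      using notin(2) by (auto simp: axis_def intro!: sum.neutral)
    have "lie_bracket (\<lambda>z. ?g z *\<^sub>R axis a 1) (\<lambda>z. ?h z *\<^sub>R axis i 1) \<in> lie_brackets F"
      by (intro lie_brackets.bracket g powers)
    also have "lie_bracket (\<lambda>z. ?g z *\<^sub>R axis a 1) (\<lambda>z. ?h z *\<^sub>R axis i 1) z =
        (c * (\<Prod>s\<in>insert a S. z $ s ^ \<alpha> s)) *\<^sub>R axis i 1" for z
      unfolding lie_bracket_axis[OF dg has_derivative_coordinate_power] g'_i
      using notin(1) by (simp add: mult_ac)
    then have "lie_bracket (\<lambda>z. ?g z *\<^sub>R axis a 1) (\<lambda>z. ?h z *\<^sub>R axis i 1) =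
        (\<lambda>z. (c * (\<Prod>s\<in>insert a S. z $ s ^ \<alpha> s)) *\<^sub>R axis i 1)" ..
    finally show ?thesis .
  qed
  have "(\<lambda>z. (c * (\<Prod>s\<in>S. z $ s ^ \<alpha> s)) *\<^sub>R axis i 1) \<in> lie_brackets F" if "i \<notin> S" for i and S :: "'m set"
    using finite[of S] that
  \<comment> \<open>The target must vary: to bring in coordinate \<open>a\<close>, the product over
    \<open>S\<close> is first needed in direction \<open>a\<close>, which is legitimate since
    \<open>a \<notin> S\<close>.\<close>
  proof (induction S arbitrary: i rule: finite_induct)
    case empty
    show ?case using powers[of c _ 0 i] by simp
  next
    case (insert a S)
    then show ?case by (intro insert_step) auto
  qed
  then have "(\<lambda>z. (c * (\<Prod>s\<in>UNIV - {i}. z $ s ^ \<alpha> s)) *\<^sub>R axis i 1) \<in> lie_brackets F" by simp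
  \<comment> \<open>Here \<open>a = i\<close>: both bracketed fields point along
    \<open>axis i 1\<close>, and the target's own coordinate enters last.\<close>
  from insert_step[OF this, of i] show ?thesis
    by (simp add: insert_absorb)
qed

subsection \<open>Ownership of the coordinates\<close>

text \<open>Existence is by induction on the number of blocks: a position beyond the first
  \<open>n\<close> blocks lies in the next one. Uniqueness holds because a later block starts only
  after all of an earlier one has been counted (\<open>mono\<close>).\<close>

lemma ex1_block:
  fixes p :: "nat \<Rightarrow> nat"
  assumes "s \<in> {1..\<Sum>k=1..n. p k}"
  shows "\<exists>!k. k \<in> {1..n} \<and> (\<exists>l\<in>{1..p k}. s = (\<Sum>j=1..<k. p j) + l)"
proof -
  have mono: "(\<Sum>j=1..<k. p j) + p k \<le> (\<Sum>j=1..<k'. p j)" if "k < k'" "1 \<le> k" for k k'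
  proof -
    have "(\<Sum>j=1..<k. p j) + p k = (\<Sum>j=1..<Suc k. p j)" using that by simp
    also have "\<dots> \<le> (\<Sum>j=1..<k'. p j)" using that by (intro sum_mono2) auto
    finally show ?thesis .
  qed
  have "\<exists>k. k \<in> {1..n} \<and> (\<exists>l\<in>{1..p k}. s = (\<Sum>j=1..<k. p j) + l)"
    using assms
  proof (induction n)
    case (Suc n)
    show ?case
    proof (cases "s \<le> (\<Sum>k=1..n. p k)")
      case True
      then show ?thesis using Suc by fastforce
    next
      case False
      moreover have "{1..<Suc n} = {1..n}" by auto
      ultimately show ?thesis using Suc.prems
        by (intro exI[of _ "Suc n"]) (auto intro!: bexI[of _ "s - (\<Sum>k=1..n. p k)"])
    qed
  qed simp
  moreover have "k = k'"
    if "k \<in> {1..n}" "k' \<in> {1..n}" "l \<in> {1..p k}" "l' \<in> {1..p k'}"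
      "s = (\<Sum>j=1..<k. p j) + l" "s = (\<Sum>j=1..<k'. p j) + l'" for k k' l l'
    using mono[of k k'] mono[of k' k] that by (cases k k' rule: linorder_cases) auto
  ultimately show ?thesis by blast
qed

lemma block_le:
  fixes p :: "nat \<Rightarrow> nat"
  assumes "k \<in> {1..n}" "l \<in> {1..p k}"
  shows "(\<Sum>j=1..<k. p j) + l \<le> (\<Sum>j=1..n. p j)"
proof -
  have "(\<Sum>j=1..<k. p j) + p k = (\<Sum>j=1..<Suc k. p j)" using assms by simp
  also have "\<dots> \<le> (\<Sum>j=1..n. p j)" using assms by (intro sum_mono2) auto
  finally show ?thesis using assms by simp
qed

lemma agent_indices_subset:
  assumes "k \<in> {1..n}"
  shows "agent_indices n p q k \<subseteq> {1..state_dim n p q}"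
  using assms block_le[of k n _ p] block_le[of k n _ q]
  unfolding agent_indices_def state_dim_def by fastforce

text \<open>The segments of \<open>x\<close>, \<open>\<nu>\<close> and \<open>\<lambda>\<close> are
  disjoint, and inside the two multiplier segments the claim reduces to \<open>ex1_block\<close>
  after removing the offset. This is what makes the owner of a coordinate well defined.\<close>

lemma ex1_agent:
  assumes "s \<in> {1..state_dim n p q}"
  shows "\<exists>!k. k \<in> {1..n} \<and> s \<in> agent_indices n p q k"
proof -
  let ?P = "\<Sum>k=1..n. p k"
  \<comment> \<open>The inequalities record the segment of \<open>s\<close>, so that the
    natural-number subtractions are exact.\<close>
  have mem: "s \<in> agent_indices n p q k \<longleftrightarrow> s = k
      \<or> (n < s \<and> s \<le> n + ?P \<and> (\<exists>l\<in>{1..p k}. s - n = (\<Sum>j=1..<k. p j) + l))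
      \<or> (n + ?P < s \<and> (\<exists>l\<in>{1..q k}. s - n - ?P = (\<Sum>j=1..<k. q j) + l))"
    if "k \<in> {1..n}" for k
    using block_le[OF that, of _ p] unfolding agent_indices_def by fastforce
  consider "s \<in> {1..n}" | "n < s" "s \<le> n + ?P" | "n + ?P < s" "s \<le> n + ?P + (\<Sum>k=1..n. q k)"
    using assms by (fastforce simp: state_dim_def)
  then show ?thesis
  proof cases
    case 1
    then have "k \<in> {1..n} \<and> s \<in> agent_indices n p q k \<longleftrightarrow> k = s" for k using mem by auto
    then show ?thesis by simp
  next
    case 2
    then have eq: "k \<in> {1..n} \<and> s \<in> agent_indices n p q k \<longleftrightarrow>
        k \<in> {1..n} \<and> (\<exists>l\<in>{1..p k}. s - n = (\<Sum>j=1..<k. p j) + l)" for k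
      using mem[of k] by (cases "k \<in> {1..n}") auto
    show ?thesis unfolding eq by (rule ex1_block) (use 2 in \<open>auto\<close>)
  next
    case 3
    then have eq: "k \<in> {1..n} \<and> s \<in> agent_indices n p q k \<longleftrightarrow>
        k \<in> {1..n} \<and> (\<exists>l\<in>{1..q k}. s - n - ?P = (\<Sum>j=1..<k. q j) + l)" for k
      using mem[of k] by auto
    show ?thesis unfolding eq by (rule ex1_block) (use 3 in \<open>auto\<close>)
  qed
qed

section \<open>From graph connectivity to monomial fields\<close>

lemma reachable_imp_rtrancl:
  assumes "u \<rightarrow>\<^sup>*\<^bsub>with_proj G\<^esub> v"
  shows "(u, v) \<in> (parcs G)\<^sup>*"
  using assms unfolding reachable_def
  by (induction rule: rtrancl_on_induct) auto

lemma monomial_field_in_admissible_lie_brackets: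
  fixes \<iota> :: "nat \<Rightarrow> 'm::finite"
  assumes wf: "pair_wf_digraph G" and verts: "pverts G = {1..n}"
    and conn: "strongly_connected (with_proj G)"
    and bij: "bij_betw \<iota> {1..state_dim n p q} (UNIV :: 'm set)"
  shows "(\<lambda>z. (c * (\<Prod>s\<in>UNIV. z $ s ^ \<alpha> s)) *\<^sub>R axis i 1)
      \<in> lie_brackets {f. smooth f \<and> admissible G n p q \<iota> f}"
proof -
  \<comment> \<open>Ownership is moved from positions to the index type \<open>'m\<close> through
    the inverse of \<open>\<iota>\<close>, so the path argument can be run on \<open>'m\<close>
    directly.\<close>
  define owner where "owner m = (THE k. k \<in> {1..n} \<and> the_inv_into {1..state_dim n p q} \<iota> m
      \<in> agent_indices n p q k)" for m
  have owner_eq: "owner (\<iota> s) = k" if "k \<in> {1..n}" "s \<in> agent_indices n p q k" for k s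
  proof -
    have s: "s \<in> {1..state_dim n p q}" using agent_indices_subset that by blast
    then have "the_inv_into {1..state_dim n p q} \<iota> (\<iota> s) = s"
      using bij by (simp add: bij_betw_def the_inv_into_f_f)
    then show ?thesis
      unfolding owner_def using ex1_agent[OF s] that by (auto intro: the1_equality)
  qed
  have owner_mem: "\<exists>s. m = \<iota> s \<and> s \<in> agent_indices n p q (owner m) \<and> owner m \<in> {1..n}" for m
  proof -
    obtain s where s: "s \<in> {1..state_dim n p q}" "m = \<iota> s"
      using bij by (metis UNIV_I bij_betw_imp_surj_on imageE)
    then show ?thesis using ex1_agent[OF s(1)] owner_eq by metis
  qed
  have "(\<lambda>z. (c * z $ j ^ k) *\<^sub>R axis i 1) \<in> {f. smooth f \<and> admissible G n p q \<iota> f}"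
    if "owner i = owner j \<or> (owner i, owner j) \<in> parcs G" for c k and i j :: 'm
  proof -
    obtain t where t: "j = \<iota> t" "t \<in> agent_indices n p q (owner j)" using owner_mem by blast
    have "admissible G n p q \<iota> (\<lambda>z. (c * z $ j ^ k) *\<^sub>R axis i 1)"
      unfolding admissible_def
    proof (intro ballI allI impI)
      fix u s and z w :: "real ^ 'm"
      assume *: "u \<in> {1..n}" "s \<in> agent_indices n p q u"
        and eq: "\<forall>r\<in>agent_indices n p q u \<union> (\<Union>l\<in>{l. (u, l) \<in> parcs G}. agent_indices n p q l).
          z $ \<iota> r = w $ \<iota> r"
      show "((c * z $ j ^ k) *\<^sub>R axis i 1) $ \<iota> s = ((c * w $ j ^ k) *\<^sub>R axis i 1) $ \<iota> s"
      \<comment> \<open>Only component \<open>i\<close> can be nonzero. Its owner sees coordinate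
        \<open>j\<close>, either as its own or along an arc.\<close>
      proof (cases "\<iota> s = i")
        case True
        then have "owner i = u" using owner_eq * by blast
        then have "owner j = u \<or> (u, owner j) \<in> parcs G" using that by auto
        then have "z $ \<iota> t = w $ \<iota> t" using t(2) by (intro eq[rule_format]) auto
        then have "z $ j = w $ j" using t(1) by simp
        then show ?thesis by simp
      next
        case False
        then show ?thesis by (simp add: axis_def)
      qed
    qed
    then show ?thesis by (simp add: smooth_coordinate_power)
  qed
  \<comment> \<open>Even an agent without multipliers owns its state coordinate, at position
    \<open>v\<close>.\<close>
  moreover have "v \<in> range owner" if "(u, v) \<in> parcs G" for u v
  proof -
    have "v \<in> {1..n}"
      using pair_wf_digraph.in_arcsD2[OF wf that] verts by simp
    then have "owner (\<iota> v) = v" by (rule owner_eq) (simp add: agent_indices_def)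
    then show ?thesis by (metis rangeI)
  qed
  moreover have "(owner i, owner j) \<in> (parcs G)\<^sup>*" for i j
    using conn owner_mem[of i] owner_mem[of j] verts
    by (intro reachable_imp_rtrancl) (auto simp: strongly_connected_def)
  ultimately have "(\<lambda>z. (c * z $ j ^ k) *\<^sub>R axis i 1)
      \<in> lie_brackets {f. smooth f \<and> admissible G n p q \<iota> f}" for c k i j
    by (rule coordinate_power_field_in_lie_brackets)
  then show ?thesis by (rule monomial_field_in_lie_brackets)
qed

subsection \<open>Polynomial approximation\<close>

text \<open>Summability at one point \<open>a + (d, ..., d)\<close> is absolute and dominates the
  series on \<open>ball a d\<close>. The Weierstrass test then makes the local sum a uniform limit
  of polynomials.\<close>

lemma real_analytic_imp_continuous:
  fixes \<phi> :: "real ^ 'm::finite \<Rightarrow> real"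
  assumes "real_analytic \<phi>"
  shows "continuous_on UNIV \<phi>"
proof -
  have "isCont \<phi> a" for a
  proof -
    obtain r c where "r > 0" and sum: "\<And>z. z \<in> ball a r \<Longrightarrow>
        ((\<lambda>\<alpha>::'m \<Rightarrow> nat. c \<alpha> * (\<Prod>s\<in>UNIV. (z $ s - a $ s) ^ \<alpha> s)) has_sum \<phi> z) UNIV"
      using assms unfolding real_analytic_def by meson
    \<comment> \<open>The l1 norm of the constant vector \<open>d\<close> is \<open>r / 2\<close>,
      so the diagonal point stays inside \<open>ball a r\<close>.\<close>
    define d where "d = r / (2 * real CARD('m))"
    have d: "d > 0" "real CARD('m) * d < r" "d < r"
      using \<open>r > 0\<close> zero_less_card_finite[where 'a='m]
      by (auto simp: d_def field_simps less_le_trans[of 1 2])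
    have "norm (\<chi> s::'m. d) < r"
      using norm_le_l1_cart[of "\<chi> s::'m. d"] d by simp
    then have "a + (\<chi> s. d) \<in> ball a r" by (simp add: dist_norm)
    from has_sum_imp_summable[OF sum[OF this]]
    have "(\<lambda>\<alpha>::'m \<Rightarrow> nat. c \<alpha> * (\<Prod>s\<in>UNIV. d ^ \<alpha> s)) summable_on UNIV"
      by simp
    then have "(\<lambda>\<alpha>::'m \<Rightarrow> nat. norm (c \<alpha> * (\<Prod>s\<in>UNIV. d ^ \<alpha> s))) summable_on UNIV"
      by (rule iffD1[OF summable_on_iff_abs_summable_on_real])
    moreover have "norm (c \<alpha> * (\<Prod>s\<in>UNIV. (z $ s - a $ s) ^ \<alpha> s)) \<le> norm (c \<alpha> * (\<Prod>s\<in>UNIV. d ^ \<alpha> s))"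
      if "z \<in> ball a d" for \<alpha> :: "'m \<Rightarrow> nat" and z
    proof -
      have "\<bar>z $ s - a $ s\<bar> \<le> d" for s
        using component_le_norm_cart[of "z - a" s] that by (simp add: dist_norm norm_minus_commute)
      then have "(\<Prod>s\<in>UNIV. \<bar>z $ s - a $ s\<bar> ^ \<alpha> s) \<le> (\<Prod>s\<in>UNIV. d ^ \<alpha> s)"
        by (intro prod_mono) (auto intro: power_mono)
      then show ?thesis
        using d(1) by (auto simp: abs_mult abs_prod power_abs intro!: mult_left_mono)
    qed
    ultimately have "uniform_limit (ball a d)
        (\<lambda>X z. \<Sum>\<alpha>\<in>X. c \<alpha> * (\<Prod>s\<in>UNIV. (z $ s - a $ s) ^ \<alpha> s)) \<phi> (finite_subsets_at_top UNIV)"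
      using sum d(3) by (intro Weierstrass_m_test_general') auto
    then have "continuous_on (ball a d) \<phi>"
      by (rule uniform_limit_theorem[rotated]) (auto intro!: always_eventually continuous_intros)
    then show "isCont \<phi> a"
      using d(1) continuous_on_eq_continuous_at[of "ball a d" \<phi>] by simp
  qed
  then show ?thesis by (simp add: continuous_at_imp_continuous_on)
qed

text \<open>A list may repeat exponents, so no collecting of terms is required: addition appends
  lists, and multiplication runs over all pairs of terms, adding exponents. A linear function is
  expanded in the standard basis.\<close>

lemma real_polynomial_function_sum_monomials:
  fixes f :: "real ^ 'm::finite \<Rightarrow> real"
  assumes "real_polynomial_function f"
  shows "\<exists>cs :: (real \<times> ('m \<Rightarrow> nat)) list.
    \<forall>z. f z = (\<Sum>(c, \<alpha>)\<leftarrow>cs. c * (\<Prod>s\<in>UNIV. z $ s ^ \<alpha> s))"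
  using assms
proof (induction rule: real_polynomial_function.induct)
  case (linear f)
  obtain ms :: "'m list" where ms: "set ms = UNIV" "distinct ms"
    using finite_distinct_list[of "UNIV :: 'm set"] by auto
  have "f z = (\<Sum>(c, \<alpha>)\<leftarrow>map (\<lambda>t. (f (axis t 1), \<lambda>s. if s = t then 1 else 0)) ms.
      c * (\<Prod>s\<in>UNIV. z $ s ^ \<alpha> s))" for z
  proof -
    interpret bounded_linear f by fact
    have "f z = f (\<Sum>t\<in>UNIV. z $ t *\<^sub>R axis t 1)" by (simp add: basis_expansion flip: scalar_mult_eq_scaleR)
    also have "\<dots> = (\<Sum>t\<in>UNIV. f (axis t 1) * z $ t)" by (simp add: sum scaleR mult.commute)
    also have "\<dots> = (\<Sum>t\<leftarrow>ms. f (axis t 1) * z $ t)"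
      using ms by (simp add: sum_list_distinct_conv_sum_set)
    also have "(\<lambda>t. z $ t) = (\<lambda>t. \<Prod>s\<in>UNIV. z $ s ^ (if s = t then 1 else 0))"
      by (simp add: if_distrib[of "power _"] cong: if_cong)
    finally show ?thesis by (simp add: comp_def)
  qed
  then show ?case by blast
next
  case (const c)
  show ?case by (intro exI[of _ "[(c, \<lambda>_. 0)]"]) simp
next
  case (add f g)
  then obtain cs ds :: "(real \<times> ('m \<Rightarrow> nat)) list"
    where "\<And>z. f z = (\<Sum>(c, \<alpha>)\<leftarrow>cs. c * (\<Prod>s\<in>UNIV. z $ s ^ \<alpha> s))"
      and "\<And>z. g z = (\<Sum>(c, \<alpha>)\<leftarrow>ds. c * (\<Prod>s\<in>UNIV. z $ s ^ \<alpha> s))" by blast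
  then show ?case by (intro exI[of _ "cs @ ds"]) simp
next
  case (mult f g)
  then obtain cs ds :: "(real \<times> ('m \<Rightarrow> nat)) list"
    where f: "\<And>z. f z = (\<Sum>(c, \<alpha>)\<leftarrow>cs. c * (\<Prod>s\<in>UNIV. z $ s ^ \<alpha> s))"
      and g: "\<And>z. g z = (\<Sum>(c, \<alpha>)\<leftarrow>ds. c * (\<Prod>s\<in>UNIV. z $ s ^ \<alpha> s))" by blast
  have "(\<Sum>(c, \<alpha>)\<leftarrow>cs. c * (\<Prod>s\<in>UNIV. z $ s ^ \<alpha> s)) *
      (\<Sum>(c, \<alpha>)\<leftarrow>ds. c * (\<Prod>s\<in>UNIV. z $ s ^ \<alpha> s)) =
      (\<Sum>(c, \<alpha>)\<leftarrow>concat (map (\<lambda>(c, \<alpha>). map (\<lambda>(d, \<beta>). (c * d, \<lambda>s. \<alpha> s + \<beta> s)) ds) cs).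
        c * (\<Prod>s\<in>UNIV. z $ s ^ \<alpha> s))" for z :: "real ^ 'm"
  proof (induction cs)
    case (Cons x cs)
    obtain c \<alpha> where "x = (c, \<alpha>)" by force
    have "c * (\<Prod>s\<in>UNIV. z $ s ^ \<alpha> s) * (\<Sum>(c, \<alpha>)\<leftarrow>ds. c * (\<Prod>s\<in>UNIV. z $ s ^ \<alpha> s)) =
        (\<Sum>(c, \<alpha>)\<leftarrow>map (\<lambda>(d, \<beta>). (c * d, \<lambda>s. \<alpha> s + \<beta> s)) ds. c * (\<Prod>s\<in>UNIV. z $ s ^ \<alpha> s))"
      by (induction ds) (auto simp: algebra_simps power_add prod.distrib)
    then show ?case using Cons \<open>x = (c, \<alpha>)\<close> by (simp add: distrib_right)
  qed simp
  then show ?case unfolding f g by (intro exI allI)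
qed

subsection \<open>Series whose partial sums converge term by term\<close>

text \<open>Every entry is scaled by \<open>1 / L\<close> and the resulting list is repeated
  \<open>L\<close> times. A prefix consists of \<open>t\<close> full copies, contributing
  \<open>t / L\<close> of the total, and one partial copy, whose contribution is at most
  \<open>C / L\<close> on \<open>K\<close>.\<close>

lemma sum_list_small_multiples:
  fixes D :: "('a \<Rightarrow> 'b::real_normed_vector) list"
  assumes bdd: "\<And>f. f \<in> set D \<Longrightarrow> bounded (f ` K)" and "e > 0"
  obtains ys where
    "set ys \<subseteq> (\<Union>f\<in>set D. range (\<lambda>c z. c *\<^sub>R f z))"
    "D \<noteq> [] \<longrightarrow> ys \<noteq> []"
    "\<And>z. (\<Sum>f\<leftarrow>ys. f z) = (\<Sum>f\<leftarrow>D. f z)"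
    "\<And>l. \<exists>t\<in>{0..1}. \<forall>z\<in>K. norm ((\<Sum>f\<leftarrow>take l ys. f z) - t *\<^sub>R (\<Sum>f\<leftarrow>D. f z)) \<le> e"
proof -
  have "\<exists>C. \<forall>z\<in>K. \<forall>l. norm (\<Sum>f\<leftarrow>take l D. f z) \<le> C"
    using bdd
  proof (induction D)
    case (Cons f D)
    then obtain C where C: "norm (\<Sum>f\<leftarrow>take l D. f z) \<le> C" if "z \<in> K" for z l
      by (metis list.set_intros(2))
    obtain C' where C': "norm (f z) \<le> C'" if "z \<in> K" for z
      using Cons.prems[of f] by (auto simp: bounded_iff)
    have "norm (\<Sum>g\<leftarrow>take l (f # D). g z) \<le> C' + C" if "z \<in> K" for z l
    proof (cases l)
      case 0
      then show ?thesis using order_trans[OF norm_ge_zero C'[OF that]] C[OF that, of 0] by simp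
    next
      case (Suc l')
      then show ?thesis using C'[OF that] C[OF that, of l'] by (simp add: norm_triangle_mono)
    qed
    then show ?case by blast
  qed (auto intro: exI[of _ 0])
  then obtain C where C: "norm (\<Sum>f\<leftarrow>take l D. f z) \<le> C" if "z \<in> K" for z l by blast
  obtain L :: nat where L: "L > 0" "C / real L \<le> e"
  proof -
    obtain L :: nat where "C / e < real L" using reals_Archimedean2 by blast
    then have "C / real (Suc L) \<le> e" using \<open>e > 0\<close> by (simp add: field_simps)
    then show ?thesis using that by blast
  qed
  define D' where "D' = map (\<lambda>f z. (1 / real L) *\<^sub>R f z) D"
  have D'_take: "(\<Sum>f\<leftarrow>take l D'. f z) = (1 / real L) *\<^sub>R (\<Sum>f\<leftarrow>take l D. f z)" for l z
  proof -
    have "(\<Sum>f\<leftarrow>map (\<lambda>f z. (1 / real L) *\<^sub>R f z) E. f z) = (1 / real L) *\<^sub>R (\<Sum>f\<leftarrow>E. f z)"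
      for E :: "('a \<Rightarrow> 'b) list"
      by (induction E) (auto simp: scaleR_add_right)
    then show ?thesis unfolding D'_def take_map .
  qed
  have D'_sum: "(\<Sum>f\<leftarrow>D'. f z) = (1 / real L) *\<^sub>R (\<Sum>f\<leftarrow>D. f z)" for z
    using D'_take[where l = "length D"] by (simp add: D'_def)
  have total: "(\<Sum>f\<leftarrow>concat (replicate r D'). f z) = (real r / real L) *\<^sub>R (\<Sum>f\<leftarrow>D. f z)" for r z
    by (induction r) (auto simp: D'_sum add_divide_distrib scaleR_add_left)
  \<comment> \<open>\<open>t\<close> counts the completed copies and \<open>l'\<close> is the
    position reached in the unfinished one.\<close>
  have prefix: "\<exists>t\<le>r. \<exists>l'. \<forall>z. (\<Sum>f\<leftarrow>take l (concat (replicate r D')). f z) =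
      (real t / real L) *\<^sub>R (\<Sum>f\<leftarrow>D. f z) + (1 / real L) *\<^sub>R (\<Sum>f\<leftarrow>take l' D. f z)" for l r
  proof (induction r arbitrary: l)
    case 0
    show ?case by (auto intro: exI[of _ 0])
  next
    case (Suc r)
    show ?case
    proof (cases "l \<le> length D'")
      case True
      then show ?thesis by (intro exI[of _ 0] conjI exI[of _ l]) (auto simp: D'_take)
    next
      case False
      obtain t l' where "t \<le> r" and eq: "\<And>z. (\<Sum>f\<leftarrow>take (l - length D') (concat (replicate r D')). f z) =
          (real t / real L) *\<^sub>R (\<Sum>f\<leftarrow>D. f z) + (1 / real L) *\<^sub>R (\<Sum>f\<leftarrow>take l' D. f z)"
        using Suc.IH by blast
      then show ?thesis using False
        by (intro exI[of _ "Suc t"] conjI exI[of _ l'])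
           (auto simp: D'_sum add_divide_distrib scaleR_add_left)
    qed
  qed
  show ?thesis
  proof
    let ?ys = "concat (replicate L D')"
    show "set ?ys \<subseteq> (\<Union>f\<in>set D. range (\<lambda>c z. c *\<^sub>R f z))"
      by (auto simp: D'_def)
    show "D \<noteq> [] \<longrightarrow> ?ys \<noteq> []"
      using L(1) by (auto simp: D'_def)
    show "(\<Sum>f\<leftarrow>?ys. f z) = (\<Sum>f\<leftarrow>D. f z)" for z
      using L(1) by (simp add: total)
    show "\<exists>t\<in>{0..1}. \<forall>z\<in>K. norm ((\<Sum>f\<leftarrow>take l ?ys. f z) - t *\<^sub>R (\<Sum>f\<leftarrow>D. f z)) \<le> e" for l
    proof -
      obtain t l' where t: "t \<le> L" and eq: "\<And>z. (\<Sum>f\<leftarrow>take l ?ys. f z) =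
          (real t / real L) *\<^sub>R (\<Sum>f\<leftarrow>D. f z) + (1 / real L) *\<^sub>R (\<Sum>f\<leftarrow>take l' D. f z)"
        using prefix by blast
      have "norm ((1 / real L) *\<^sub>R (\<Sum>f\<leftarrow>take l' D. f z)) \<le> e" if "z \<in> K" for z
        using divide_right_mono[OF C[OF that, of l'], of "real L"] L by simp
      then show ?thesis using t L(1) by (intro bexI[of _ "real t / real L"]) (auto simp: eq)
    qed
  qed
qed

text \<open>The difference between a better approximant \<open>fs\<close> and \<open>xs\<close> is
  appended in small portions. Each intermediate sum is within \<open>e\<close> of a convex
  combination of the two approximants, whose own error on \<open>K\<close> is below
  \<open>e\<close>; together this gives \<open>2 * e\<close>.\<close>

lemma ex_extension_close_partial_sums:
  fixes M :: "('a \<Rightarrow> 'b::real_normed_vector) set"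
  assumes scale: "\<And>c f. f \<in> M \<Longrightarrow> (\<lambda>z. c *\<^sub>R f z) \<in> M" and "M \<noteq> {}"
    and bdd: "\<And>f. f \<in> M \<Longrightarrow> bounded (f ` K)"
    and approx: "\<And>e. e > 0 \<Longrightarrow> \<exists>fs. set fs \<subseteq> M \<and> (\<forall>z\<in>K'. norm ((\<Sum>f\<leftarrow>fs. f z) - T z) < e)"
    and "K \<subseteq> K'" "0 < e'" "e' \<le> e"
    and xs: "set xs \<subseteq> M" "\<forall>z\<in>K. norm ((\<Sum>f\<leftarrow>xs. f z) - T z) < e"
  obtains ys where "set ys \<subseteq> M" "ys \<noteq> []"
    "\<forall>z\<in>K'. norm ((\<Sum>f\<leftarrow>xs @ ys. f z) - T z) < e'"
    "\<forall>l. \<forall>z\<in>K. norm ((\<Sum>f\<leftarrow>xs @ take l ys. f z) - T z) < 2 * e"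
proof -
  obtain fs where fs: "set fs \<subseteq> M" "\<And>z. z \<in> K' \<Longrightarrow> norm ((\<Sum>f\<leftarrow>fs. f z) - T z) < e'"
    using approx[OF \<open>0 < e'\<close>] by blast
  obtain f0 where f0: "f0 \<in> M" using \<open>M \<noteq> {}\<close> by blast
  \<comment> \<open>The zero field in front keeps \<open>D\<close>, and hence \<open>ys\<close>,
    nonempty, so that the lists built from such extensions grow strictly.\<close>
  define D where "D = (\<lambda>z. 0 *\<^sub>R f0 z) # fs @ map (\<lambda>f z. (- 1) *\<^sub>R f z) xs"
  have D_M: "set D \<subseteq> M" using fs xs(1) scale[OF f0, of 0] scale[of _ "- 1"] by (auto simp: D_def)
  have D_sum: "(\<Sum>f\<leftarrow>D. f z) = (\<Sum>f\<leftarrow>fs. f z) - (\<Sum>f\<leftarrow>xs. f z)" for z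
  proof -
    have "(\<Sum>f\<leftarrow>map (\<lambda>f z. (- 1) *\<^sub>R f z) xs. f z) = - (\<Sum>f\<leftarrow>xs. f z)"
      by (induction xs) auto
    then show ?thesis by (simp add: D_def)
  qed
  have "e > 0" using assms by simp
  have bdd_D: "bounded (f ` K)" if "f \<in> set D" for f using bdd D_M that by blast
  obtain ys where ys: "set ys \<subseteq> (\<Union>f\<in>set D. range (\<lambda>c z. c *\<^sub>R f z))"
    "D \<noteq> [] \<longrightarrow> ys \<noteq> []" "\<And>z. (\<Sum>f\<leftarrow>ys. f z) = (\<Sum>f\<leftarrow>D. f z)"
    "\<And>l. \<exists>t\<in>{0..1}. \<forall>z\<in>K. norm ((\<Sum>f\<leftarrow>take l ys. f z) - t *\<^sub>R (\<Sum>f\<leftarrow>D. f z)) \<le> e"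
    by (rule sum_list_small_multiples[of D K e, OF bdd_D \<open>e > 0\<close>]) (assumption, rule that)
  show ?thesis
  proof
    show "set ys \<subseteq> M" using ys(1) D_M scale by blast
    show "ys \<noteq> []" using ys(2) by (simp add: D_def)
    show "\<forall>z\<in>K'. norm ((\<Sum>f\<leftarrow>xs @ ys. f z) - T z) < e'"
      using fs(2) by (simp add: ys(3) D_sum)
    show "\<forall>l. \<forall>z\<in>K. norm ((\<Sum>f\<leftarrow>xs @ take l ys. f z) - T z) < 2 * e"
    proof (intro allI ballI)
      fix l z assume "z \<in> K"
      obtain t where t: "t \<in> {0..1}"
        "norm ((\<Sum>f\<leftarrow>take l ys. f z) - t *\<^sub>R (\<Sum>f\<leftarrow>D. f z)) \<le> e" using ys(4) \<open>z \<in> K\<close> by blast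
      define X where "X = (\<Sum>f\<leftarrow>xs. f z) - T z"
      define Y where "Y = (\<Sum>f\<leftarrow>fs. f z) - T z"
      have "norm X < e" "norm Y < e"
        using xs(2) fs(2) \<open>z \<in> K\<close> \<open>K \<subseteq> K'\<close> \<open>e' \<le> e\<close> by (force simp: X_def Y_def)+
      then have "(1 - t) *\<^sub>R X + t *\<^sub>R Y \<in> ball 0 e"
        using t(1) by (intro convexD[OF convex_ball]) auto
      then have "norm ((1 - t) *\<^sub>R X + t *\<^sub>R Y) < e" by simp
      moreover have "(\<Sum>f\<leftarrow>xs @ take l ys. f z) - T z =
          ((1 - t) *\<^sub>R X + t *\<^sub>R Y) + ((\<Sum>f\<leftarrow>take l ys. f z) - t *\<^sub>R (\<Sum>f\<leftarrow>D. f z))"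
        by (simp add: X_def Y_def D_sum algebra_simps)
      ultimately show "norm ((\<Sum>f\<leftarrow>xs @ take l ys. f z) - T z) < 2 * e"
        using t(2) by (simp only:) (rule norm_triangle_lt, linarith)
    qed
  qed
qed

text \<open>Dependent choice builds lists, each a proper prefix of the next, with
  \<open>xs j\<close> accurate to \<open>1 / Suc j\<close> on \<open>K j\<close>. Their common
  extension is the sequence \<open>B\<close>; \<open>Q\<close> controls the partial sums that end
  between two consecutive lists.\<close>

lemma ex_series_of_approximable:
  fixes M :: "('a \<Rightarrow> 'b::real_normed_vector) set" and K :: "nat \<Rightarrow> 'a set"
  assumes scale: "\<And>c f. f \<in> M \<Longrightarrow> (\<lambda>z. c *\<^sub>R f z) \<in> M" and "M \<noteq> {}"
    and bdd: "\<And>f j. f \<in> M \<Longrightarrow> bounded (f ` K j)"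
    and approx: "\<And>e j. e > 0 \<Longrightarrow> \<exists>fs. set fs \<subseteq> M \<and> (\<forall>z\<in>K j. norm ((\<Sum>f\<leftarrow>fs. f z) - T z) < e)"
    and "mono K"
  obtains B where "\<And>k. B k \<in> M"
    "\<And>J. uniform_limit (K J) (\<lambda>m z. \<Sum>k<m. B k z) T sequentially"
proof -
  let ?e = "\<lambda>j. 1 / real (Suc j)"
  define P where "P j xs \<longleftrightarrow> set xs \<subseteq> M \<and> (\<forall>z\<in>K j. norm ((\<Sum>f\<leftarrow>xs. f z) - T z) < ?e j)" for j xs
  define Q where "Q j xs xs' \<longleftrightarrow> (\<exists>ys. xs' = xs @ ys \<and> ys \<noteq> [] \<and>
      (\<forall>l. \<forall>z\<in>K j. norm ((\<Sum>f\<leftarrow>xs @ take l ys. f z) - T z) < 2 * ?e j))" for j xs xs'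
  have "\<exists>xs. \<forall>j. P j (xs j) \<and> Q j (xs j) (xs (Suc j))"
  proof (rule dependent_nat_choice)
    show "\<exists>xs. P 0 xs" using approx[of "?e 0" 0] by (auto simp: P_def)
    fix xs j assume "P j xs"
    then have xs: "set xs \<subseteq> M" "\<forall>z\<in>K j. norm ((\<Sum>f\<leftarrow>xs. f z) - T z) < ?e j" by (auto simp: P_def)
    have K: "K j \<subseteq> K (Suc j)" using \<open>mono K\<close> by (simp add: mono_def)
    have e: "0 < ?e (Suc j)" "?e (Suc j) \<le> ?e j" by (auto simp: field_simps)
    show "\<exists>ys. P (Suc j) ys \<and> Q j xs ys"
    proof (rule ex_extension_close_partial_sums[OF scale \<open>M \<noteq> {}\<close> bdd approx K e xs])
      fix ys
      assume "set ys \<subseteq> M" "ys \<noteq> []"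
        "\<forall>z\<in>K (Suc j). norm ((\<Sum>f\<leftarrow>xs @ ys. f z) - T z) < ?e (Suc j)"
        "\<forall>l. \<forall>z\<in>K j. norm ((\<Sum>f\<leftarrow>xs @ take l ys. f z) - T z) < 2 * ?e j"
      then show ?thesis
        using xs(1) by (intro exI[of _ "xs @ ys"]) (auto simp: P_def Q_def)
    qed
  qed
  then obtain xs where P: "\<And>j. P j (xs j)" and Q: "\<And>j. Q j (xs j) (xs (Suc j))" by blast
  have take_xs: "take (length (xs j)) (xs (Suc j)) = xs j"
    and len_Suc: "length (xs j) < length (xs (Suc j))" for j
    using Q[of j] by (auto simp: Q_def)
  have len: "strict_mono (\<lambda>j. length (xs j))" using len_Suc by (simp add: strict_mono_Suc_iff)
  have len_ge: "j \<le> length (xs j)" for j using strict_mono_imp_increasing[OF len] .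
  \<comment> \<open>List number \<open>Suc k\<close> has at least \<open>Suc k\<close> entries, so
    entry \<open>k\<close> exists; by the prefix property any other list that is long enough gives
    the same entry.\<close>
  define B where "B k = xs (Suc k) ! k" for k
  have prefix: "take (length (xs i)) (xs j) = xs i" if "i \<le> j" for i j
    using that
  proof (induction j rule: dec_induct)
    case (step j)
    have "take (length (xs i)) (xs (Suc j)) = take (length (xs i)) (take (length (xs j)) (xs (Suc j)))"
      using strict_mono_less_eq[OF len, of i j] step by (simp add: min_def)
    then show ?case using take_xs step by simp
  qed simp
  have B_nth: "B k = xs j ! k" if "k < length (xs j)" for k j
  proof -
    have k: "k < length (xs (Suc k))" using len_ge[of "Suc k"] by simp
    show ?thesis
    proof (cases "j \<le> Suc k")
      case True
      then show ?thesis using prefix[OF True] that unfolding B_def by (metis nth_take)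
    next
      case False
      then show ?thesis using prefix[of "Suc k" j] k unfolding B_def by (metis nth_take nat_le_linear)
    qed
  qed
  have partial: "(\<Sum>k<m. B k z) = (\<Sum>f\<leftarrow>take m (xs j). f z)" if "m \<le> length (xs j)" for m j z
  proof -
    have "(\<Sum>f\<leftarrow>take m (xs j). f z) = (\<Sum>k<m. (xs j ! k) z)"
      using that by (simp add: sum_list_sum_nth atLeast0LessThan)
    then show ?thesis using that by (simp add: B_nth[of _ j])
  qed
  show ?thesis
  proof
    fix k show "B k \<in> M"
      using P[of "Suc k"] len_ge[of "Suc k"] unfolding B_def P_def by (auto dest: nth_mem)
  next
    fix J show "uniform_limit (K J) (\<lambda>m z. \<Sum>k<m. B k z) T sequentially"
    proof (rule uniform_limitI)
      fix e :: real assume "e > 0"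
      then obtain J0 :: nat where J0: "2 / e < real J0" using reals_Archimedean2 by blast
      \<comment> \<open>From stage \<open>N\<close> on, \<open>J\<close> ensures that
        \<open>K J\<close> lies in \<open>K j\<close>, and \<open>J0\<close> brings the error bound
        below \<open>e\<close>.\<close>
      define N where "N = max J J0"
      have N: "2 * ?e j < e" if "j \<ge> N" for j
      proof -
        have "2 / e < real (Suc j)" using that J0 by (simp add: N_def)
        then show ?thesis using \<open>e > 0\<close> by (simp add: field_simps)
      qed
      have "dist (\<Sum>k<m. B k z) (T z) < e" if m: "m \<ge> length (xs N)" and z: "z \<in> K J" for m z
      proof -
        \<comment> \<open>The first list longer than \<open>m\<close> is not the first of all,
          because \<open>m \<ge> length (xs N)\<close>. Its predecessor \<open>xs j\<close> has
          length at most \<open>m\<close>, so the partial sum ends inside the extension of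
          \<open>xs j\<close>.\<close>
        define i where "i = (LEAST i. m < length (xs i))"
        have ex: "m < length (xs (Suc m))" using len_ge[of "Suc m"] by simp
        then have i: "m < length (xs i)" unfolding i_def by (rule LeastI)
        then have "N < i" using m strict_mono_less[OF len, of N i] by auto
        then obtain j where j: "i = Suc j" "j \<ge> N" by (cases i) auto
        have "\<not> m < length (xs j)" using j(1) not_less_Least[of j "\<lambda>i. m < length (xs i)"] unfolding i_def by auto
        moreover obtain ys where ys: "xs (Suc j) = xs j @ ys"
          "\<And>l z. z \<in> K j \<Longrightarrow> norm ((\<Sum>f\<leftarrow>xs j @ take l ys. f z) - T z) < 2 * ?e j"
          using Q[of j] unfolding Q_def by blast
        ultimately have "(\<Sum>k<m. B k z) = (\<Sum>f\<leftarrow>xs j @ take (m - length (xs j)) ys. f z)"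
          using partial[of m "Suc j" z] i j(1) by simp
        moreover have "z \<in> K j"
          using z j(2) monoD[OF \<open>mono K\<close>, of J j] by (auto simp: N_def)
        ultimately have "dist (\<Sum>k<m. B k z) (T z) < 2 * ?e j"
          unfolding dist_norm using ys(2) by metis
        then show ?thesis using N[OF j(2)] by simp
      qed
      then show "\<forall>\<^sub>F m in sequentially. \<forall>z\<in>K J. dist (\<Sum>k<m. B k z) (T z) < e"
        unfolding eventually_sequentially by blast
    qed
  qed
qed

section \<open>Assembly over an exhaustion by balls\<close>

theorem lemma3:
  fixes G :: "nat pair_pre_digraph"
    and n :: nat
    and p q :: "nat \<Rightarrow> nat"
    and \<iota> :: "nat \<Rightarrow> 'm::finite"
    and \<phi> :: "real ^ 'm \<Rightarrow> real"
    and i :: nat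
  assumes "pair_wf_digraph G"
    and "pverts G = {1..n}"
    and "strongly_connected (with_proj G)"
    and "bij_betw \<iota> {1..state_dim n p q} (UNIV :: 'm set)"
    and "real_analytic \<phi>"
    and "i \<in> {1..state_dim n p q}"
  shows "\<exists>B :: nat \<Rightarrow> real ^ 'm \<Rightarrow> real ^ 'm.
           (\<forall>k. B k \<in> lie_brackets {f. smooth f \<and> admissible G n p q \<iota> f}) \<and>
           (\<forall>K. compact K \<longrightarrow>
              uniform_limit K (\<lambda>m z. \<Sum>k<m. B k z) (\<lambda>z. \<phi> z *\<^sub>R axis (\<iota> i) 1) sequentially)"
proof -
  define mon :: "real \<Rightarrow> ('m \<Rightarrow> nat) \<Rightarrow> real ^ 'm \<Rightarrow> real ^ 'm"
    where "mon c \<alpha> z = (c * (\<Prod>s\<in>UNIV. z $ s ^ \<alpha> s)) *\<^sub>R axis (\<iota> i) 1" for c \<alpha> z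
  define M where "M = {mon c \<alpha> | c \<alpha>. True}"
  have "(\<lambda>z. c *\<^sub>R f z) \<in> M" if "f \<in> M" for c f
  proof -
    obtain d \<alpha> where "f = mon d \<alpha>" using \<open>f \<in> M\<close> by (auto simp: M_def)
    then have "(\<lambda>z. c *\<^sub>R f z) = mon (c * d) \<alpha>" by (auto simp: mon_def mult.assoc)
    then show ?thesis by (auto simp: M_def)
  qed
  moreover have "M \<noteq> {}" by (auto simp: M_def)
  moreover have "bounded (f ` cball 0 (real j))" if "f \<in> M" for f j
  proof -
    have "continuous_on (cball 0 (real j)) f"
      using that by (auto simp: M_def mon_def[abs_def] intro!: continuous_intros)
    then show ?thesis by (intro compact_imp_bounded compact_continuous_image compact_cball)
  qed
  moreover have "\<exists>fs. set fs \<subseteq> M \<and>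
      (\<forall>z\<in>cball 0 (real j). norm ((\<Sum>f\<leftarrow>fs. f z) - \<phi> z *\<^sub>R axis (\<iota> i) 1) < e)" if "e > 0" for e j
  proof -
    have "continuous_on (cball 0 (real j)) \<phi>"
      using real_analytic_imp_continuous[OF assms(5)] continuous_on_subset by blast
    then obtain g where g: "real_polynomial_function g"
      "\<And>z. z \<in> cball 0 (real j) \<Longrightarrow> \<bar>\<phi> z - g z\<bar> < e"
      using Stone_Weierstrass_real_polynomial_function[OF compact_cball _ \<open>e > 0\<close>] by blast
    obtain cs :: "(real \<times> ('m \<Rightarrow> nat)) list"
      where cs: "\<And>z. g z = (\<Sum>(c, \<alpha>)\<leftarrow>cs. c * (\<Prod>s\<in>UNIV. z $ s ^ \<alpha> s))"
      using real_polynomial_function_sum_monomials[OF g(1)] by blast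
    have "(\<Sum>f\<leftarrow>map (\<lambda>(c, \<alpha>). mon c \<alpha>) cs. f z) = g z *\<^sub>R axis (\<iota> i) 1" for z
      unfolding cs by (induction cs) (auto simp: mon_def scaleR_add_left)
    moreover have "norm (g z *\<^sub>R axis (\<iota> i) (1::real) - \<phi> z *\<^sub>R axis (\<iota> i) 1) = \<bar>\<phi> z - g z\<bar>" for z
      by (simp flip: scaleR_diff_left)
    ultimately show ?thesis
      using g(2) by (intro exI[of _ "map (\<lambda>(c, \<alpha>). mon c \<alpha>) cs"]) (auto simp: M_def)
  qed
  moreover have "mono (\<lambda>j. cball (0 :: real ^ 'm) (real j))"
    by (auto simp: mono_def)
  ultimately obtain B where B: "\<And>k. B k \<in> M" "\<And>J. uniform_limit (cball 0 (real J))
      (\<lambda>m z. \<Sum>k<m. B k z) (\<lambda>z. \<phi> z *\<^sub>R axis (\<iota> i) 1) sequentially"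
    using ex_series_of_approximable[of M "\<lambda>j. cball 0 (real j)" "\<lambda>z. \<phi> z *\<^sub>R axis (\<iota> i) 1"] by blast
  have "B k \<in> lie_brackets {f. smooth f \<and> admissible G n p q \<iota> f}" for k
  proof -
    obtain c \<alpha> where "B k = mon c \<alpha>" using B(1)[of k] by (auto simp: M_def)
    then have "B k = (\<lambda>z. (c * (\<Prod>s\<in>UNIV. z $ s ^ \<alpha> s)) *\<^sub>R axis (\<iota> i) 1)"
      by (simp add: mon_def[abs_def])
    then show ?thesis
      by (simp only: monomial_field_in_admissible_lie_brackets[OF assms(1-4)])
  qed
  moreover have "uniform_limit K (\<lambda>m z. \<Sum>k<m. B k z) (\<lambda>z. \<phi> z *\<^sub>R axis (\<iota> i) 1) sequentially"
    if "compact K" for K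
  proof -
    obtain b where b: "\<And>z. z \<in> K \<Longrightarrow> norm z \<le> b"
      using compact_imp_bounded[OF \<open>compact K\<close>] by (auto simp: bounded_iff)
    \<comment> \<open>Every compact set lies in one of the exhausting balls, where uniform
      convergence is already known.\<close>
    obtain J where "b \<le> real J" using real_arch_simple by blast
    then have "K \<subseteq> cball 0 (real J)" using b by force
    with B(2) show ?thesis by (rule uniform_limit_on_subset)
  qed
  ultimately show ?thesis by blast
qed

end
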